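(* Let $L$ be a poset, endowed with its Scott topology, which is core-compact and join-continuous. Then the $D$-completion of $L$ coincides with the sobrification of $L$.
   Context: Every poset $L$ carries its Scott topology $\sigma(L)$: $U$ is Scott open iff $U$ is an upper set and every directed $D\subseteq L$ whose supremum exists and lies in $U$ meets $U$. $\Gamma(L)$ is the set of Scott closed sets. A space $X$ is core-compact if its lattice $\mathcal O(X)$ of open sets is a continuous lattice; $L$ is core-compact if $(L,\sigma(L))$ is. Let $up(L)$ be the set of all upper sets of $L$, with the upper Vietoris topology generated by the sets $\Box U=\{B\in up(L): B\subseteq U\}$, $U\in\sigma(L)$. $L$ is join-continuous if for every $x\in L$ the map $f_x:(L,\sigma(L))\to up(L)$, $f_x(y)=\mathord{\uparrow}x\cap\mathord{\uparrow}y$, is continuous. For a $T_0$ space $X$ (here $X=(L,\sigma(L))$, whose specialization order is the order of $L$): the lower Vietoris topology on a family of closed sets has as subbasis the sets $\diamondsuit U=\{A: A\cap U\neq\emptyset\}$, $U$ open in $X$. The sobrification of $X$ is the set $\mathbf{IRR}(X)$ of (nonempty) irreducible closed subsets with the lower Vietoris topology, with embedding $x\mapsto\mathord{\downarrow}x=cl(\{x\})$. A monotone convergence space is a $T_0$ space in which the closure of every directed set (in the specialization order) is the closure of a unique point. A subset of a poset is $d$-closed if it contains the supremum (when it exists) of each of its directed subsets; $cl_d(B)$ is the smallest $d$-closed set containing $B$. A $D$-completion of $X$ is a monotone convergence space $Y$ with a topological embedding $j:X\to Y$ such that $cl_d(j(X))=Y$. It is unique up to homeomorphism; its standard form is the $d$-closure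 of $\{\mathord{\downarrow}x:x\in X\}$ in $(\Gamma(X),\subseteq)$ with the lower Vietoris topology, and it is contained in $\mathbf{IRR}(X)$. "Coincides" means that this subset of $\Gamma(X)$ equals $\mathbf{IRR}(X)$. *)

theory Defs
  imports "HOL-Analysis.Analysis" "HOL-Library.Lub_Glb"
begin

text \<open>A poset is an arbitrary subset \<open>P\<close> (possibly empty) of a partially ordered type, with the
  induced order; \<^term>\<open>P = UNIV\<close> gives the posets that are whole types.  The lattices of open and of
  closed sets of a space are families \<open>P\<close> in a type of sets, ordered by inclusion.
  \<^prop>\<open>isLub P D s\<close> says that \<open>s\<close> is the supremum of \<open>D\<close> relative to \<open>P\<close>.\<close>

definition directed :: "'a::order set \<Rightarrow> bool" where
  "directed D \<longleftrightarrow> D \<noteq> {} \<and> (\<forall>x\<in>D. \<forall>y\<in>D. \<exists>z\<in>D. x \<le> z \<and> y \<le> z)"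

definition upper_set_in :: "'a::order set \<Rightarrow> 'a set \<Rightarrow> bool" where
  "upper_set_in P U \<longleftrightarrow> U \<subseteq> P \<and> (\<forall>x\<in>U. \<forall>y\<in>P. x \<le> y \<longrightarrow> y \<in> U)"

definition scott_open :: "'a::order set \<Rightarrow> 'a set \<Rightarrow> bool" where
  "scott_open P U \<longleftrightarrow> upper_set_in P U \<and>
     (\<forall>D s. D \<subseteq> P \<and> directed D \<and> isLub P D s \<and> s \<in> U \<longrightarrow> D \<inter> U \<noteq> {})"

definition scott :: "'a::order set \<Rightarrow> 'a topology" where
  "scott P = topology (scott_open P)"

lemma istopology_scott_open: "istopology (scott_open P)"
  unfolding istopology_def
proof (intro conjI allI impI)
  fix U V assume U: "scott_open P U" and V: "scott_open P V"
  have "D \<inter> (U \<inter> V) \<noteq> {}"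
    if D: "D \<subseteq> P" "directed D" "isLub P D s" "s \<in> U \<inter> V" for D s
  proof -
    have "D \<inter> U \<noteq> {}" "D \<inter> V \<noteq> {}"
      using U V D unfolding scott_open_def by auto
    then obtain a b where a: "a \<in> D" "a \<in> U" and b: "b \<in> D" "b \<in> V"
      by blast
    then obtain c where "c \<in> D" "a \<le> c" "b \<le> c"
      using D(2) unfolding directed_def by blast
    moreover have "upper_set_in P U" "upper_set_in P V"
      using U V by (auto simp: scott_open_def)
    ultimately show ?thesis
      using D(1) a(2) b(2) unfolding upper_set_in_def by blast
  qed
  moreover have "upper_set_in P (U \<inter> V)"
    using U V unfolding scott_open_def upper_set_in_def by blast
  ultimately show "scott_open P (U \<inter> V)"
    unfolding scott_open_def by (intro conjI allI impI) (assumption, elim conjE)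
next
  fix K assume K: "\<forall>U\<in>K. scott_open P U"
  have "D \<inter> \<Union>K \<noteq> {}"
    if D: "D \<subseteq> P" "directed D" "isLub P D s" and "s \<in> \<Union>K" for D s
  proof -
    obtain U where "U \<in> K" "s \<in> U"
      using \<open>s \<in> \<Union>K\<close> by blast
    then have "D \<inter> U \<noteq> {}"
      using K D unfolding scott_open_def by auto
    then show ?thesis
      using \<open>U \<in> K\<close> by blast
  qed
  moreover have "upper_set_in P (\<Union>K)"
    using K unfolding scott_open_def upper_set_in_def by blast
  ultimately show "scott_open P (\<Union>K)"
    unfolding scott_open_def by (intro conjI allI impI) (assumption, elim conjE)
qed

lemma openin_scott: "openin (scott P) U \<longleftrightarrow> scott_open P U"
  by (simp add: scott_def istopology_scott_open topology_inverse')

lemma topspace_scott [simp]: "topspace (scott P) = P"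
proof -
  have "scott_open P P"
    unfolding scott_open_def upper_set_in_def directed_def by (auto simp: Int_absorb2)
  then show ?thesis
    unfolding topspace_def openin_scott by (auto simp: scott_open_def upper_set_in_def)
qed

lemma scott_closure_of_singleton:
  assumes "x \<in> P"
  shows "scott P closure_of {x} = {y \<in> P. y \<le> x}"
proof
  have "scott_open P {y \<in> P. \<not> y \<le> x}"
    unfolding scott_open_def
  proof (intro conjI allI impI)
    show "upper_set_in P {y \<in> P. \<not> y \<le> x}"
      unfolding upper_set_in_def using order_trans by blast
  next
    fix D s assume D: "D \<subseteq> P \<and> directed D \<and> isLub P D s \<and> s \<in> {y \<in> P. \<not> y \<le> x}"
    show "D \<inter> {y \<in> P. \<not> y \<le> x} \<noteq> {}"
    proof
      assume "D \<inter> {y \<in> P. \<not> y \<le> x} = {}"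
      then have "isUb P D x"
        using D assms by (intro isUbI setleI) blast+
      then show False
        using D isLub_le_isUb by blast
    qed
  qed
  then have "closedin (scott P) (P - {y \<in> P. \<not> y \<le> x})"
    by (metis closedin_diff closedin_topspace openin_scott topspace_scott)
  moreover have "P - {y \<in> P. \<not> y \<le> x} = {y \<in> P. y \<le> x}"
    by blast
  ultimately show "scott P closure_of {x} \<subseteq> {y \<in> P. y \<le> x}"
    using assms by (intro closure_of_minimal) auto
next
  show "{y \<in> P. y \<le> x} \<subseteq> scott P closure_of {x}"
    using assms by (auto simp: in_closure_of openin_scott scott_open_def upper_set_in_def)
qed


definition way_below :: "'a::order set \<Rightarrow> 'a \<Rightarrow> 'a \<Rightarrow> bool" where
  "way_below P x y \<longleftrightarrow> x \<in> P \<and> y \<in> P \<and>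
     (\<forall>D s. D \<subseteq> P \<and> directed D \<and> isLub P D s \<and> y \<le> s \<longrightarrow> (\<exists>d\<in>D. x \<le> d))"

text \<open>In a complete lattice the set of elements way below \<open>x\<close> is automatically directed, so this is
  not required separately.\<close>

definition continuous_lattice :: "'a::order set \<Rightarrow> bool" where
  "continuous_lattice P \<longleftrightarrow> (\<forall>A\<subseteq>P. \<exists>s. isLub P A s) \<and>
     (\<forall>x\<in>P. isLub P {y. way_below P y x} x)"

definition core_compact :: "'a topology \<Rightarrow> bool" where
  "core_compact X \<longleftrightarrow> continuous_lattice {U. openin X U}"


definition upper_vietoris :: "'a::order set \<Rightarrow> 'a set topology" where
  "upper_vietoris P =
     topology_generated_by {{B. upper_set_in P B \<and> B \<subseteq> U} |U. openin (scott P) U}"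

definition join_continuous :: "'a::order set \<Rightarrow> bool" where
  "join_continuous P \<longleftrightarrow>
     (\<forall>x\<in>P. continuous_map (scott P) (upper_vietoris P) (\<lambda>y. {z \<in> P. x \<le> z} \<inter> {z \<in> P. y \<le> z}))"

lemma topspace_upper_vietoris: "topspace (upper_vietoris P) = {B. upper_set_in P B}"
proof -
  have "openin (scott P) P"
    using openin_topspace[of "scott P"] by simp
  then show ?thesis
    by (auto simp: upper_vietoris_def upper_set_in_def)
qed


text \<open>The family \<open>\<F>\<close> itself is inserted because the subbasic sets do not cover it when \<open>\<F>\<close> contains
  the empty set.\<close>

definition lower_vietoris :: "'a topology \<Rightarrow> 'a set set \<Rightarrow> 'a set topology" where
  "lower_vietoris X \<F> =
     topology_generated_by (insert \<F> {{A \<in> \<F>. A \<inter> U \<noteq> {}} |U. openin X U})"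

lemma topspace_lower_vietoris [simp]: "topspace (lower_vietoris X \<F>) = \<F>"
  by (auto simp: lower_vietoris_def)

lemma lower_vietoris_eq_iff: "lower_vietoris X \<F> = lower_vietoris X \<G> \<longleftrightarrow> \<F> = \<G>"
  by (metis topspace_lower_vietoris)

definition irreducible_closedin :: "'a topology \<Rightarrow> 'a set \<Rightarrow> bool" where
  "irreducible_closedin X A \<longleftrightarrow> closedin X A \<and> A \<noteq> {} \<and>
     (\<forall>B C. closedin X B \<and> closedin X C \<and> A = B \<union> C \<longrightarrow> A = B \<or> A = C)"

definition sobrification :: "'a topology \<Rightarrow> 'a set topology" where
  "sobrification X = lower_vietoris X {A. irreducible_closedin X A}"

definition d_closed :: "'a::order set \<Rightarrow> 'a set \<Rightarrow> bool" where
  "d_closed P B \<longleftrightarrow> B \<subseteq> P \<and> (\<forall>D s. D \<subseteq> B \<and> directed D \<and> isLub P D s \<longrightarrow> s \<in> B)"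

definition d_closure :: "'a::order set \<Rightarrow> 'a set \<Rightarrow> 'a set" where
  "d_closure P A = \<Inter>{B. d_closed P B \<and> A \<subseteq> B}"

text \<open>The standard form of the \<open>D\<close>-completion: the \<open>d\<close>-closure of the point closures in the complete
  lattice of closed sets.  The embedding of \<open>X\<close>, here as for the sobrification, sends a point to
  its closure; by \<open>lower_vietoris_eq_iff\<close> the two spaces are equal iff their sets of points are.\<close>

definition D_completion :: "'a topology \<Rightarrow> 'a set topology" where
  "D_completion X =
     lower_vietoris X (d_closure {A. closedin X A} {X closure_of {x} |x. x \<in> topspace X})"

end

theory Submission
  imports Defs
begin

text \<open>
  The \<open>D\<close>-completion and the sobrification are lower Vietoris spaces on two families of closed sets,
  so the point is that the two families agree.  One inclusion holds in every space: point closures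
  are irreducible, and irreducibility survives directed suprema in the lattice of closed sets, so
  the \<open>d\<close>-closure of the point closures consists of irreducible closed sets.

  The other inclusion rests on \<open>directed_if_irreducible_closedin_scott\<close>: under the two hypotheses
  every irreducible Scott closed set \<open>A\<close> is itself directed in \<open>L\<close>.  Then \<open>A\<close> is the supremum, among
  closed sets, of the directed family of the point closures of its elements, so a single directed
  supremum already reaches it.

  To see that \<open>A\<close> is directed, suppose that \<open>x, y \<in> A\<close> have no common upper bound in \<open>A\<close>, that is,
  \<open>\<up>x \<inter> \<up>y\<close> lies in the open complement \<open>U\<close> of \<open>A\<close>.  Join-continuity says that the set \<open>f(x)\<close> of all
  \<open>y\<close> with \<open>\<up>x \<inter> \<up>y \<subseteq> U\<close> is open.  The relation ``\<open>y \<in> f(x)\<close>'' is symmetric, so the openness of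
  each \<open>f(y)\<close> makes \<open>f\<close>, as a map into the lattice of open sets, preserve directed suprema.
  Core-compactness provides an open \<open>V\<close> containing \<open>y\<close> and way below \<open>f(x)\<close>, and, by interpolation,
  makes \<open>W = {x'. V \<lless> f(x')}\<close> Scott open (\<open>scott_open_separation\<close>).  Every point \<open>z\<close> of \<open>W \<inter> V\<close>
  satisfies \<open>z \<in> f(z)\<close>, hence lies in \<open>U\<close>.  So \<open>W\<close> and \<open>V\<close> are open sets that both meet \<open>A\<close> while
  their intersection does not, which contradicts irreducibility.
\<close>

section \<open>The way-below relation between open sets\<close>

lemma isLub_openin_iff:
  assumes "\<D> \<subseteq> {U. openin X U}"
  shows "isLub {U. openin X U} \<D> S \<longleftrightarrow> S = \<Union>\<D>"
proof
  have Un: "openin X (\<Union>\<D>)"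
    using assms by blast
  show "S = \<Union>\<D>" if S: "isLub {U. openin X U} \<D> S"
  proof
    have "isUb {U. openin X U} \<D> (\<Union>\<D>)"
      using Un by (intro isUbI setleI) auto
    then show "S \<subseteq> \<Union>\<D>"
      using S isLub_le_isUb by blast
    show "\<Union>\<D> \<subseteq> S"
      using S isLubD2 by blast
  qed
  show "isLub {U. openin X U} \<D> S" if "S = \<Union>\<D>"
    using Un unfolding that by (auto simp: isLub_def leastP_def isUb_def setle_def setge_def)
qed

lemma way_below_openin_iff:
  "way_below {U. openin X U} V W \<longleftrightarrow> openin X V \<and> openin X W \<and>
     (\<forall>\<D>. (\<forall>U\<in>\<D>. openin X U) \<and> directed \<D> \<and> W \<subseteq> \<Union>\<D> \<longrightarrow> (\<exists>U\<in>\<D>. V \<subseteq> U))"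
proof -
  have "\<D> \<subseteq> {U. openin X U} \<longleftrightarrow> (\<forall>U\<in>\<D>. openin X U)" for \<D>
    by blast
  then show ?thesis
    unfolding way_below_def by (metis isLub_openin_iff mem_Collect_eq)
qed

lemma way_below_openinD:
  assumes "way_below {U. openin X U} V W"
  shows "openin X V" "openin X W"
  using assms by (simp_all add: way_below_def)

lemma way_below_openin_mono:
  assumes "way_below {U. openin X U} V W" "openin X V'" "V' \<subseteq> V" "openin X W'" "W \<subseteq> W'"
  shows "way_below {U. openin X U} V' W'"
  using assms unfolding way_below_openin_iff by (meson order_trans)

lemma way_below_openin_subset:
  assumes "way_below {U. openin X U} V W"
  shows "V \<subseteq> W"
proof -
  have "directed {W}"
    by (simp add: directed_def)
  moreover have "openin X W" "W \<subseteq> \<Union>{W}"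
    using assms by (auto simp: way_below_openin_iff)
  ultimately show ?thesis
    using assms unfolding way_below_openin_iff by blast
qed

lemma way_below_openin_empty:
  assumes "openin X W"
  shows "way_below {U. openin X U} {} W"
  using assms unfolding way_below_openin_iff directed_def by auto

lemma way_below_openin_Un:
  assumes "way_below {U. openin X U} V W" "way_below {U. openin X U} V' W"
  shows "way_below {U. openin X U} (V \<union> V') W"
  unfolding way_below_openin_iff
proof (intro conjI allI impI)
  show "openin X (V \<union> V')" "openin X W"
    using assms by (auto simp: way_below_openin_iff)
  fix \<D> assume \<D>: "(\<forall>U\<in>\<D>. openin X U) \<and> directed \<D> \<and> W \<subseteq> \<Union>\<D>"
  then obtain U U' where "U \<in> \<D>" "V \<subseteq> U" "U' \<in> \<D>" "V' \<subseteq> U'"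
    using assms unfolding way_below_openin_iff by meson
  moreover from this obtain U'' where "U'' \<in> \<D>" "U \<subseteq> U''" "U' \<subseteq> U''"
    using \<D> unfolding directed_def by meson
  ultimately show "\<exists>U\<in>\<D>. V \<union> V' \<subseteq> U"
    by blast
qed

lemma core_compact_way_below:
  assumes "core_compact X" "openin X W" "y \<in> W"
  obtains V where "way_below {U. openin X U} V W" "y \<in> V"
proof -
  have "isLub {U. openin X U} {V. way_below {U. openin X U} V W} W"
    using assms unfolding core_compact_def continuous_lattice_def by blast
  moreover have "{V. way_below {U. openin X U} V W} \<subseteq> {U. openin X U}"
    by (auto simp: way_below_openin_iff)
  ultimately have "W = \<Union>{V. way_below {U. openin X U} V W}"
    using isLub_openin_iff by blast
  then show thesis
    using assms(3) that by blast
qed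

text \<open>The open sets that are two way-below steps beneath \<open>W\<close> form a directed cover of \<open>W\<close>, and
  testing \<open>V \<lless> W\<close> on this cover produces the set in between.\<close>

lemma core_compact_interpolation:
  assumes "core_compact X" "way_below {U. openin X U} V W"
  obtains I where "way_below {U. openin X U} V I" "way_below {U. openin X U} I W"
proof -
  let ?wb = "way_below {U. openin X U}"
  define \<E> where "\<E> = {E. \<exists>I. ?wb E I \<and> ?wb I W}"
  have W: "openin X W"
    using assms(2) by (simp add: way_below_openin_iff)
  have "?wb {} {}" "?wb {} W"
    using W by (simp_all add: way_below_openin_empty)
  then have "{} \<in> \<E>"
    unfolding \<E>_def by blast
  moreover have "\<exists>G\<in>\<E>. E \<subseteq> G \<and> F \<subseteq> G" if EF: "E \<in> \<E>" "F \<in> \<E>" for E F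
  proof -
    obtain I J where I: "?wb E I" "?wb I W" and J: "?wb F J" "?wb J W"
      using EF unfolding \<E>_def by blast
    have "?wb (I \<union> J) W"
      using I J by (simp add: way_below_openin_Un)
    moreover have "?wb E (I \<union> J)" "?wb F (I \<union> J)"
      using I J by (auto intro: way_below_openin_mono way_below_openinD)
    ultimately have "E \<union> F \<in> \<E>"
      using way_below_openin_Un[of X E "I \<union> J" F] unfolding \<E>_def by auto
    then show ?thesis
      by (rule bexI[rotated]) simp
  qed
  ultimately have "directed \<E>"
    unfolding directed_def by blast
  moreover have "W \<subseteq> \<Union>\<E>"
  proof
    fix y assume "y \<in> W"
    then obtain I where I: "?wb I W" "y \<in> I"
      using core_compact_way_below[OF assms(1) W] by blast
    then obtain E where "?wb E I" "y \<in> E"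
      using core_compact_way_below[OF assms(1)] way_below_openin_iff by metis
    then show "y \<in> \<Union>\<E>"
      using I unfolding \<E>_def by blast
  qed
  moreover have "\<forall>E\<in>\<E>. openin X E"
    unfolding \<E>_def way_below_openin_iff by blast
  ultimately obtain E where "E \<in> \<E>" "V \<subseteq> E"
    using assms(2) unfolding way_below_openin_iff by blast
  then obtain I where I: "?wb E I" "?wb I W"
    unfolding \<E>_def by blast
  have "?wb V I"
    using way_below_openin_mono[OF I(1)] \<open>V \<subseteq> E\<close> way_below_openinD[OF I(1)]
      way_below_openinD[OF assms(2)] by blast
  then show thesis
    using I that by blast
qed

section \<open>Irreducible closed sets in core-compact join-continuous posets\<close>

lemma join_continuous_openin:
  assumes "join_continuous L" "x \<in> L" "openin (scott L) U"
  shows "openin (scott L) {y \<in> L. {z \<in> L. x \<le> z} \<inter> {z \<in> L. y \<le> z} \<subseteq> U}"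
proof -
  have "continuous_map (scott L) (upper_vietoris L)
          (\<lambda>y. {z \<in> L. x \<le> z} \<inter> {z \<in> L. y \<le> z})"
    using assms by (simp add: join_continuous_def)
  moreover have "openin (upper_vietoris L) {B. upper_set_in L B \<and> B \<subseteq> U}"
    unfolding upper_vietoris_def using assms(3) by (intro topology_generated_by_Basis) blast
  ultimately have
    "openin (scott L) {y \<in> topspace (scott L).
       {z \<in> L. x \<le> z} \<inter> {z \<in> L. y \<le> z} \<in> {B. upper_set_in L B \<and> B \<subseteq> U}}"
    by (rule openin_continuous_map_preimage)
  moreover have "upper_set_in L ({z \<in> L. x \<le> z} \<inter> {z \<in> L. y \<le> z})" for y
    unfolding upper_set_in_def using order_trans by blast
  ultimately show ?thesis
    by simp
qed

text \<open>Join-continuity is a condition in each variable separately; core-compactness turns it into a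
  joint one, namely a whole open rectangle around \<open>(x, y)\<close> on which common upper bounds stay in \<open>U\<close>.\<close>

lemma scott_open_separation:
  fixes L :: "'a::order set"
  assumes cc: "core_compact (scott L)" and jc: "join_continuous L"
    and U: "openin (scott L) U" and x: "x \<in> L" and y: "y \<in> L"
    and xy: "{z \<in> L. x \<le> z} \<inter> {z \<in> L. y \<le> z} \<subseteq> U"
  obtains V W where "openin (scott L) V" "openin (scott L) W" "x \<in> W" "y \<in> V"
    "\<forall>x'\<in>W. \<forall>y'\<in>V. {z \<in> L. x' \<le> z} \<inter> {z \<in> L. y' \<le> z} \<subseteq> U"
proof -
  let ?wb = "way_below {U. openin (scott L) U}"
  define f where "f x = {y \<in> L. {z \<in> L. x \<le> z} \<inter> {z \<in> L. y \<le> z} \<subseteq> U}" for x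
  have f_open: "openin (scott L) (f x)" if "x \<in> L" for x
    using join_continuous_openin[OF jc that U] by (simp add: f_def)
  have f_mono: "f a \<subseteq> f b" if "a \<le> b" for a b
    unfolding f_def using that by (auto dest: order_trans)
  have f_sym: "b \<in> f a \<Longrightarrow> a \<in> L \<Longrightarrow> a \<in> f b" for a b
    unfolding f_def by blast
  have "y \<in> f x"
    using xy y by (simp add: f_def)
  then obtain V where V: "?wb V (f x)" "y \<in> V"
    using core_compact_way_below[OF cc f_open[OF x]] by blast
  define W where "W = {a \<in> L. ?wb V (f a)}"
  have "scott_open L W"
    unfolding scott_open_def
  proof (intro conjI allI impI)
    show "upper_set_in L W"
      unfolding upper_set_in_def W_def
      using way_below_openin_mono[OF _ way_below_openinD(1)[OF V(1)] order_refl f_open f_mono]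
      by blast
  next
    fix D s assume D: "D \<subseteq> L \<and> directed D \<and> isLub L D s \<and> s \<in> W"
    then have s: "s \<in> L" "?wb V (f s)"
      by (auto simp: W_def)
    obtain I where I: "?wb V I" "?wb I (f s)"
      using core_compact_interpolation[OF cc s(2)] by blast
    \<comment> \<open>The roles of \<open>s\<close> and \<open>b\<close> are swapped, so that the Scott open set is \<open>f b\<close>, to which the
      directed set \<open>D\<close> with supremum \<open>s\<close> applies.\<close>
    have "f s \<subseteq> \<Union>(f ` D)"
    proof
      fix b assume b: "b \<in> f s"
      then have "b \<in> L" "s \<in> f b"
        using f_sym s by (auto simp: f_def)
      then have "D \<inter> f b \<noteq> {}"
        using D f_open[of b] unfolding openin_scott scott_open_def by blast
      then show "b \<in> \<Union>(f ` D)"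
        using f_sym \<open>b \<in> L\<close> by blast
    qed
    moreover have "directed (f ` D)"
      using D f_mono unfolding directed_def by (simp add: bex_simps ball_simps) meson
    moreover have "\<forall>U\<in>f ` D. openin (scott L) U"
      using D f_open by blast
    ultimately obtain d where d: "d \<in> D" "I \<subseteq> f d"
      using I(2) unfolding way_below_openin_iff by blast
    then have "?wb V (f d)"
      using D f_open by (intro way_below_openin_mono[OF I(1) way_below_openinD(1)[OF I(1)]]) auto
    then show "D \<inter> W \<noteq> {}"
      using d D unfolding W_def by blast
  qed
  moreover have "{z \<in> L. x' \<le> z} \<inter> {z \<in> L. y' \<le> z} \<subseteq> U" if "x' \<in> W" "y' \<in> V" for x' y'
  proof -
    have "?wb V (f x')"
      using that(1) by (simp add: W_def)
    then have "y' \<in> f x'"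
      using that(2) way_below_openin_subset by (metis subsetD)
    then show ?thesis
      by (simp add: f_def)
  qed
  moreover have "x \<in> W"
    using V x by (simp add: W_def)
  ultimately show thesis
    using that[OF way_below_openinD(1)[OF V(1)] _ _ V(2)] by (simp add: openin_scott)
qed

lemma irreducible_closedin_meets_Int:
  assumes A: "irreducible_closedin X A"
    and V: "openin X V" "A \<inter> V \<noteq> {}" and W: "openin X W" "A \<inter> W \<noteq> {}"
  shows "A \<inter> V \<inter> W \<noteq> {}"
proof
  assume "A \<inter> V \<inter> W = {}"
  then have "A = (A - V) \<union> (A - W)"
    by blast
  moreover have "closedin X (A - V)" "closedin X (A - W)"
    using A V W by (auto simp: irreducible_closedin_def closedin_diff)
  ultimately have "A = A - V \<or> A = A - W"
    using A unfolding irreducible_closedin_def by blast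
  then show False
    using V W by blast
qed

lemma directed_if_irreducible_closedin_scott:
  fixes L :: "'a::order set"
  assumes cc: "core_compact (scott L)" and jc: "join_continuous L"
    and A: "irreducible_closedin (scott L) A"
  shows "directed A"
  unfolding directed_def
proof (intro conjI ballI)
  show "A \<noteq> {}"
    using A by (simp add: irreducible_closedin_def)
  fix x y assume xy: "x \<in> A" "y \<in> A"
  have AL: "A \<subseteq> L" and U: "openin (scott L) (L - A)"
    using A by (auto simp: irreducible_closedin_def closedin_def)
  show "\<exists>z\<in>A. x \<le> z \<and> y \<le> z"
  proof (rule ccontr)
    assume "\<not> (\<exists>z\<in>A. x \<le> z \<and> y \<le> z)"
    then have no_bound: "{z \<in> L. x \<le> z} \<inter> {z \<in> L. y \<le> z} \<subseteq> L - A"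
      by blast
    have "x \<in> L" "y \<in> L"
      using xy AL by auto
    then obtain V W where VW: "openin (scott L) V" "openin (scott L) W" "x \<in> W" "y \<in> V"
      and sep: "\<forall>x'\<in>W. \<forall>y'\<in>V.
        {z \<in> L. x' \<le> z} \<inter> {z \<in> L. y' \<le> z} \<subseteq> L - A"
      by (rule scott_open_separation[OF cc jc U _ _ no_bound])
    then obtain z where "z \<in> A" "z \<in> V" "z \<in> W"
      using irreducible_closedin_meets_Int[OF A, of V W] xy by blast
    then show False
      using sep AL by blast
  qed
qed

section \<open>The \<open>d\<close>-closure of the point closures\<close>

lemma irreducible_closedin_closure_of_singleton:
  assumes "x \<in> topspace X"
  shows "irreducible_closedin X (X closure_of {x})"
  unfolding irreducible_closedin_def
proof (intro conjI allI impI)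
  have x: "x \<in> X closure_of {x}"
    using assms by (simp add: in_closure_of)
  then show "X closure_of {x} \<noteq> {}"
    by blast
  fix B C assume BC: "closedin X B \<and> closedin X C \<and> X closure_of {x} = B \<union> C"
  then have "X closure_of {x} \<subseteq> B \<or> X closure_of {x} \<subseteq> C"
    using x closure_of_minimal[of "{x}"] by blast
  then show "X closure_of {x} = B \<or> X closure_of {x} = C"
    using BC by blast
qed simp

text \<open>If \<open>B \<union> C\<close> is the supremum of a directed family of irreducible sets, each member lies in \<open>B\<close> or
  in \<open>C\<close>; by directedness one of the two contains them all, and so is an upper bound.\<close>

lemma d_closed_irreducible_closedin:
  "d_closed {A. closedin X A} {A. irreducible_closedin X A}"
  unfolding d_closed_def
proof (intro conjI allI impI)
  show "{A. irreducible_closedin X A} \<subseteq> {A. closedin X A}"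
    by (auto simp: irreducible_closedin_def)
  fix \<D> S
  assume "\<D> \<subseteq> {A. irreducible_closedin X A} \<and> directed \<D> \<and> isLub {A. closedin X A} \<D> S"
  then have irr: "\<And>A. A \<in> \<D> \<Longrightarrow> irreducible_closedin X A" and dir: "directed \<D>"
    and lub: "isLub {A. closedin X A} \<D> S"
    by auto
  have S: "closedin X S"
    using isLubD1[OF lub] lub by (auto simp: isLub_def leastP_def isUb_def)
  have le: "A \<subseteq> S" if "A \<in> \<D>" for A
    using lub that isLubD2 by blast
  have least: "S \<subseteq> B" if "closedin X B" "\<And>A. A \<in> \<D> \<Longrightarrow> A \<subseteq> B" for B
    using isLub_le_isUb[OF lub isUbI[OF setleI]] that by blast
  obtain A where "A \<in> \<D>"
    using dir by (auto simp: directed_def)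
  then have "S \<noteq> {}"
    using le[of A] irr[of A] by (auto simp: irreducible_closedin_def)
  moreover have "S = B \<or> S = C" if BC: "closedin X B" "closedin X C" "S = B \<union> C" for B C
  proof -
    have either: "A \<subseteq> B \<or> A \<subseteq> C" if "A \<in> \<D>" for A
    proof -
      have "closedin X A"
        using irr[OF that] by (simp add: irreducible_closedin_def)
      then have "closedin X (A \<inter> B)" "closedin X (A \<inter> C)"
        using BC by auto
      moreover have "A = (A \<inter> B) \<union> (A \<inter> C)"
        using le[OF that] BC by blast
      ultimately have "A = A \<inter> B \<or> A = A \<inter> C"
        using irr[OF that] unfolding irreducible_closedin_def by meson
      then show ?thesis
        by blast
    qed
    have "(\<forall>A\<in>\<D>. A \<subseteq> B) \<or> (\<forall>A\<in>\<D>. A \<subseteq> C)"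
    proof (rule ccontr)
      assume "\<not> ?thesis"
      then obtain A A' where A: "A \<in> \<D>" "\<not> A \<subseteq> B" "A' \<in> \<D>" "\<not> A' \<subseteq> C"
        by blast
      then obtain A'' where "A'' \<in> \<D>" "A \<subseteq> A''" "A' \<subseteq> A''"
        using dir unfolding directed_def by blast
      then show False
        using A either[of A''] by blast
    qed
    then have "S \<subseteq> B \<or> S \<subseteq> C"
      using least BC by blast
    then show ?thesis
      using BC by blast
  qed
  ultimately show "S \<in> {A. irreducible_closedin X A}"
    using S by (auto simp: irreducible_closedin_def)
qed

lemma d_closure_point_closures_irreducible:
  assumes "A \<in> d_closure {A. closedin X A} {X closure_of {x} |x. x \<in> topspace X}"
  shows "irreducible_closedin X A"
proof -
  have "{X closure_of {x} |x. x \<in> topspace X} \<subseteq> {A. irreducible_closedin X A}"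
    by (auto intro: irreducible_closedin_closure_of_singleton)
  then show ?thesis
    using assms d_closed_irreducible_closedin[of X] unfolding d_closure_def by blast
qed

lemma directed_closedin_in_d_closure:
  fixes L :: "'a::order set"
  assumes A: "closedin (scott L) A" and dir: "directed A"
  shows "A \<in> d_closure {A. closedin (scott L) A}
               {scott L closure_of {x} |x. x \<in> topspace (scott L)}"
proof -
  let ?\<D> = "(\<lambda>x. scott L closure_of {x}) ` A"
  have AL: "A \<subseteq> L"
    using A closedin_subset by fastforce
  have down: "scott L closure_of {x} = {y \<in> L. y \<le> x}" if "x \<in> A" for x
    using that AL scott_closure_of_singleton by blast
  have "directed ?\<D>"
    unfolding directed_def
  proof (intro conjI ballI)
    show "?\<D> \<noteq> {}"
      using dir by (simp add: directed_def)
    fix E F assume "E \<in> ?\<D>" "F \<in> ?\<D>"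
    then obtain x y where xy: "x \<in> A" "E = scott L closure_of {x}"
      "y \<in> A" "F = scott L closure_of {y}"
      by blast
    then obtain z where z: "z \<in> A" "x \<le> z" "y \<le> z"
      using dir unfolding directed_def by blast
    then have "E \<subseteq> scott L closure_of {z}" "F \<subseteq> scott L closure_of {z}"
      using xy by (auto simp: down)
    then show "\<exists>G\<in>?\<D>. E \<subseteq> G \<and> F \<subseteq> G"
      using z by blast
  qed
  moreover have "isLub {A. closedin (scott L) A} ?\<D> A"
  proof -
    have "scott L closure_of {x} \<subseteq> A" if "x \<in> A" for x
      using that A by (simp add: closure_of_minimal)
    moreover have "A \<subseteq> B" if "\<And>x. x \<in> A \<Longrightarrow> scott L closure_of {x} \<subseteq> B" for B
      using that down AL by blast
    ultimately show ?thesis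
      using A by (auto simp: isLub_def leastP_def isUb_def setle_def setge_def)
  qed
  moreover have \<D>: "?\<D> \<subseteq> {scott L closure_of {x} |x. x \<in> topspace (scott L)}"
    using AL by auto
  ultimately have "A \<in> B"
    if "d_closed {A. closedin (scott L) A} B"
      "{scott L closure_of {x} |x. x \<in> topspace (scott L)} \<subseteq> B" for B
    using that(1) subset_trans[OF \<D> that(2)] unfolding d_closed_def by meson
  then show ?thesis
    unfolding d_closure_def by simp
qed

theorem theorem3p7:
  fixes L :: "'a::order set"
  assumes "core_compact (scott L)"
    and "join_continuous L"
  shows "D_completion (scott L) = sobrification (scott L)"
proof -
  have "A \<in> d_closure {A. closedin (scott L) A}
              {scott L closure_of {x} |x. x \<in> topspace (scott L)}"
    if "irreducible_closedin (scott L) A" for A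
    using that directed_if_irreducible_closedin_scott[OF assms that]
    by (intro directed_closedin_in_d_closure) (simp_all add: irreducible_closedin_def)
  then have "d_closure {A. closedin (scott L) A}
               {scott L closure_of {x} |x. x \<in> topspace (scott L)}
             = {A. irreducible_closedin (scott L) A}"
    using d_closure_point_closures_irreducible by blast
  then show ?thesis
    by (simp add: D_completion_def sobrification_def)
qed

end
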